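(* For every integer $n\ge 0$, the $(n+1)\times(n+1)$ matrix $$\left(\frac{1+(-1)^{i+j}}{2\sqrt{\pi}}\,\Gamma\!\left(\frac{i+j+1}{2}\right)\right)_{0\le i,j\le n}$$ has determinant $$\det\left(\frac{1+(-1)^{i+j}}{2\sqrt{\pi}}\,\Gamma\!\left(\frac{i+j+1}{2}\right)\right)_{i,j=0}^{n}=2^{-\frac{n(n+1)}{2}}\,G(n+2),$$ and its inverse matrix is $$\left(\sum_{k=\max(i,j)}^{n}\frac{2^{i+j}\binom{k}{i}H_{k-i}(0)\,\binom{k}{j}H_{k-j}(0)}{k!\,2^{k}}\right)_{0\le i,j\le n}.$$
   Context: $\Gamma$ is Euler's gamma function. $G$ is the Barnes $G$-function, whose values at positive integers are $G(m)=\prod_{i=0}^{m-2} i!$ (so $G(n+2)=\prod_{i=0}^{n} i!$). $H_n$ ($n\ge 0$) are the Hermite polynomials $H_n(x)=(2x)^n\,{}_2F_0\left(-\tfrac n2,-\tfrac n2+\tfrac12;-;-\tfrac1{x^2}\right)$, i.e. $H_n(x)=\sum_{m=0}^{\lfloor n/2\rfloor}\frac{(-1)^m n!}{m!\,(n-2m)!}(2x)^{n-2m}$. *)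

theory Defs
  imports "HOL-Analysis.Analysis" "Jordan_Normal_Form.Determinant"
begin

text \<open>The Barnes G-function, by its Weierstrass product: with \<open>w = z - 1\<close>,
  \<open>G(1 + w) = (2 \<pi>)^(w/2) exp (-(w + w\<^sup>2 (1 + \<gamma>)) / 2) *
    (\<Prod>k\<ge>1. (1 + w/k)^k exp (w\<^sup>2 / (2 k) - w))\<close>.\<close>

definition barnes_G :: "'a::{real_normed_field, banach} \<Rightarrow> 'a" where
  "barnes_G z =
     exp (of_real (ln (2 * pi)) * (z - 1) / 2) *
     exp (- ((z - 1) + (z - 1)\<^sup>2 * (1 + euler_mascheroni)) / 2) *
     (\<Prod>k. (1 + (z - 1) / of_nat (Suc k)) ^ Suc k *
           exp ((z - 1)\<^sup>2 / (2 * of_nat (Suc k)) - (z - 1)))"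

text \<open>The physicists' Hermite polynomials, by the explicit finite sum rather than the form
  \<open>(2x)^n \<^sub>2F\<^sub>0(-n/2, (1-n)/2; -; -1/x\<^sup>2)\<close>, which cannot be evaluated literally at \<open>x = 0\<close>.\<close>

definition hermite :: "nat \<Rightarrow> real \<Rightarrow> real" where
  "hermite n x = (\<Sum>m\<le>n div 2.
     (-1) ^ m * fact n / (fact m * fact (n - 2 * m)) * (2 * x) ^ (n - 2 * m))"

end

(*
  The entries of the matrix A are the moments of the density exp(-x^2)/sqrt(pi), for which
  the Hermite polynomials are orthogonal with squared norms k! 2^k. If C is the lower
  triangular matrix of Hermite coefficients, with diagonal entries 2^k, then
  C A C^T = D = diag(k! 2^k), hence A^-1 = C^T D^-1 C and det A = (PROD k. k! / 2^k).
  The values of the Barnes G-function follow from its Weierstrass product: raising the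
  argument by one makes the quotient of the partial products telescope, and Stirling's
  formula gives the limit.
*)

theory Submission
  imports Defs "HOL-Real_Asymp.Real_Asymp"
begin

section \<open>Stirling's formula\<close>

definition stirling_ratio :: "nat \<Rightarrow> real" where
  "stirling_ratio n = fact n * exp (real n) / (real n ^ n * sqrt (real n))"

text \<open>The increments of the logarithm are of order \<open>1 / n ^ 2\<close>, so their series
  converges; exponentiating its sum makes the limit positive. The value is left open here.\<close>

lemma stirling_ratio_convergent:
  obtains c where "c > 0" "stirling_ratio \<longlonglongrightarrow> c"
proof -
  \<comment> \<open>The shift avoids index 0, where the ratio divides by zero.\<close>
  define l where "l n = ln (stirling_ratio (Suc n))" for n
  have pos: "stirling_ratio (Suc n) > 0" for n
    by (simp add: stirling_ratio_def)
  have ln_eq: "l n = ln (fact (Suc n)) + real (Suc n) - (real (Suc n) + 1/2) * ln (real (Suc n))" for n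
    unfolding l_def stirling_ratio_def
    by (simp add: ln_mult ln_div ln_realpow ln_sqrt algebra_simps del: fact_Suc of_nat_Suc power_Suc)
  have step: "l (Suc n) - l n = 1 - (real n + 3/2) * (ln (real n + 2) - ln (real n + 1))" for n
  proof -
    have "ln (fact (Suc (Suc n)) :: real) = ln (real n + 2) + ln (fact (Suc n))"
    proof -
      have "(fact (Suc (Suc n)) :: real) = (real n + 2) * fact (Suc n)"
        by (subst fact_Suc) simp
      then show ?thesis by (simp add: ln_mult del: fact_Suc)
    qed
    then show ?thesis
      unfolding ln_eq by (simp add: algebra_simps del: fact_Suc)
  qed
  have "(\<lambda>n. 1 - (real n + 3/2) * (ln (real n + 2) - ln (real n + 1))) \<in> O(\<lambda>n. 1 / real n ^ 2)"
    by real_asymp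
  moreover have "summable (\<lambda>n. norm (1 / real n ^ 2))"
    using inverse_power_summable[of 2, where 'a = real] by (simp add: field_simps)
  ultimately have "summable (\<lambda>n. l (Suc n) - l n)"
    unfolding step by (rule summable_comparison_test_bigo[rotated])
  then have "convergent (\<lambda>n. l 0 + (\<Sum>k<n. l (Suc k) - l k))"
    by (intro convergent_add convergent_const) (simp add: summable_iff_convergent)
  then have "convergent l"
    by (simp add: sum_lessThan_telescope)
  then obtain L where "l \<longlonglongrightarrow> L" by (auto simp: convergent_def)
  then have "(\<lambda>n. exp (l n)) \<longlonglongrightarrow> exp L" by (intro tendsto_exp)
  then have "(\<lambda>n. stirling_ratio (Suc n)) \<longlonglongrightarrow> exp L"
    using pos by (simp add: l_def)
  then show ?thesis by (intro that[of "exp L"]) (auto simp: filterlim_sequentially_Suc)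
qed

lemma wallis_partial_product:
  "(\<Prod>k=1..n. (4 * real k ^ 2) / (4 * real k ^ 2 - 1)) =
     (4 ^ n * fact n ^ 2 / fact (2 * n)) ^ 2 / (2 * real n + 1)"
proof (induction n)
  case (Suc n)
  have "4 * real (Suc n) ^ 2 - 1 = (2 * real n + 1) * (2 * real n + 3)"
    by (simp add: power2_eq_square algebra_simps)
  moreover have "4 * real (Suc n) ^ 2 = (2 * real n + 2) ^ 2"
    by (simp add: power2_eq_square algebra_simps)
  ultimately have "(\<Prod>k=1..Suc n. (4 * real k ^ 2) / (4 * real k ^ 2 - 1)) =
      (4 ^ n * fact n ^ 2 / fact (2 * n)) ^ 2 / (2 * real n + 1) *
      ((2 * real n + 2) ^ 2 / ((2 * real n + 1) * (2 * real n + 3)))"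
    using Suc.IH by simp
  also have "\<dots> = (4 ^ n * fact n ^ 2 / fact (2 * n) *
      ((2 * real n + 2) / (2 * real n + 1))) ^ 2 / (2 * real n + 3)"
    by (simp add: power2_eq_square mult_ac)
  also have "4 ^ n * fact n ^ 2 / fact (2 * n) * ((2 * real n + 2) / (2 * real n + 1))
     = (4 ^ Suc n * fact (Suc n) ^ 2 / fact (2 * Suc n) :: real)"
  proof -
    define F :: real where "F = fact (2 * n)"
    have "F > 0" by (simp add: F_def)
    have "fact (2 * Suc n) = (2 * real n + 2) * (2 * real n + 1) * F"
      by (simp add: F_def algebra_simps)
    moreover have "(fact (Suc n) :: real) = (real n + 1) * fact n" by simp
    ultimately show ?thesis using \<open>F > 0\<close>
      unfolding F_def[symmetric]
      by (simp add: divide_simps del: fact_Suc) (simp add: power2_eq_square algebra_simps)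
  qed
  finally show ?case by (simp add: algebra_simps)
qed simp

text \<open>The exponentials and the powers \<open>n ^ n\<close> cancel up to \<open>4 ^ n\<close>,
  leaving \<open>4 ^ n\<close> over the central binomial coefficient, whose square is the Wallis
  product up to a rational factor.\<close>

lemma stirling_ratio_wallis:
  assumes "n > 0"
  shows "(stirling_ratio n ^ 2 / stirling_ratio (2 * n)) ^ 2 =
    (\<Prod>k=1..n. (4 * real k ^ 2) / (4 * real k ^ 2 - 1)) * ((2 * real n + 1) * 2 / real n)"
proof -
  define p s E where "p = real n ^ n" and "s = sqrt (real n)" and "E = exp (real n)"
  have nz: "p > 0" "s > 0" "E > 0" "s ^ 2 = real n" using assms by (auto simp: p_def s_def E_def)
  have E: "exp (2 * real n) = E ^ 2"
    by (simp add: E_def exp_double)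
  have p: "(2 * real n) ^ (2 * n) = 4 ^ n * p ^ 2"
    by (simp add: p_def power_mult_distrib power_mult) (simp add: power_mult[symmetric] mult.commute)
  have "stirling_ratio n ^ 2 / stirling_ratio (2 * n) =
     (fact n * E / (p * s)) ^ 2 / (fact (2 * n) * E ^ 2 / (4 ^ n * p ^ 2 * (sqrt 2 * s)))"
    using p E by (simp add: stirling_ratio_def real_sqrt_mult p_def s_def E_def)
  also have "\<dots> = 4 ^ n * fact n ^ 2 / fact (2 * n) * (sqrt 2 / s)"
    using nz(1-3) by (simp add: field_simps power2_eq_square)
  finally have "(stirling_ratio n ^ 2 / stirling_ratio (2 * n)) ^ 2 =
     (4 ^ n * fact n ^ 2 / fact (2 * n)) ^ 2 * (2 / real n)"
    by (simp add: power_mult_distrib power_divide nz)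
  moreover have "z / (2 * real n + 1) * ((2 * real n + 1) * 2 / real n) = z * (2 / real n)" for z
    by (simp add: divide_simps)
  ultimately show ?thesis unfolding wallis_partial_product by (simp only:)
qed

text \<open>If the limit is \<open>c > 0\<close>, the quotient in
  \<open>stirling_ratio_wallis\<close> tends to \<open>c ^ 2 / c = c\<close>, and Wallis' formula
  forces \<open>c ^ 2 = 2 * pi\<close>.\<close>

lemma stirling_ratio_tendsto: "stirling_ratio \<longlonglongrightarrow> sqrt (2 * pi)"
proof -
  obtain c where c: "c > 0" "stirling_ratio \<longlonglongrightarrow> c" by (rule stirling_ratio_convergent)
  have "filterlim (\<lambda>n::nat. 2 * n) at_top at_top" by real_asymp
  then have "(\<lambda>n. stirling_ratio (2 * n)) \<longlonglongrightarrow> c"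
    by (rule filterlim_compose[OF c(2)])
  then have "(\<lambda>n. (stirling_ratio n ^ 2 / stirling_ratio (2 * n)) ^ 2) \<longlonglongrightarrow> (c ^ 2 / c) ^ 2"
    using c by (intro tendsto_intros) auto
  moreover have "(\<lambda>n. (stirling_ratio n ^ 2 / stirling_ratio (2 * n)) ^ 2) \<longlonglongrightarrow> pi / 2 * 4"
  proof (rule Lim_transform_eventually)
    have "(\<lambda>n. (2 * real n + 1) * 2 / real n) \<longlonglongrightarrow> 4" by real_asymp
    then show "(\<lambda>n. (\<Prod>k=1..n. (4 * real k ^ 2) / (4 * real k ^ 2 - 1)) * ((2 * real n + 1) * 2 / real n))
        \<longlonglongrightarrow> pi / 2 * 4"
      by (intro tendsto_mult wallis)
    show "\<forall>\<^sub>F n in sequentially. (\<Prod>k=1..n. (4 * real k ^ 2) / (4 * real k ^ 2 - 1)) * ((2 * real n + 1) * 2 / real n)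
       = (stirling_ratio n ^ 2 / stirling_ratio (2 * n)) ^ 2"
      using eventually_gt_at_top[of 0] by eventually_elim (simp add: stirling_ratio_wallis)
  qed
  ultimately have "(c ^ 2 / c) ^ 2 = pi / 2 * 4" by (rule LIMSEQ_unique)
  then have "c ^ 2 = 2 * pi" using c(1) by (simp add: power2_eq_square)
  then have "c = sqrt (2 * pi)" using c(1) by (simp add: real_sqrt_unique)
  with c show ?thesis by simp
qed

section \<open>The Barnes G-function at positive integers\<close>

definition barnes_factor :: "real \<Rightarrow> nat \<Rightarrow> real" where
  "barnes_factor w k = (1 + w / real (Suc k)) ^ Suc k * exp (w\<^sup>2 / (2 * real (Suc k)) - w)"

lemma barnes_factor_plus1:
  "barnes_factor (real (Suc m)) k = barnes_factor (real m) k *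
     (((real k + real m + 2) / (real k + real m + 1)) ^ Suc k * exp ((real m + 1/2) / real (Suc k) - 1))"
proof -
  have "1 + real (Suc m) / real (Suc k) =
      (1 + real m / real (Suc k)) * ((real k + real m + 2) / (real k + real m + 1))"
    by (simp add: divide_simps) (simp add: algebra_simps)
  moreover have "(real (Suc m))\<^sup>2 / (2 * real (Suc k)) - real (Suc m) =
      ((real m)\<^sup>2 / (2 * real (Suc k)) - real m) + ((real m + 1/2) / real (Suc k) - 1)"
    by (simp add: divide_simps) (simp add: power2_eq_square algebra_simps)
  ultimately show ?thesis
    unfolding barnes_factor_def by (simp only: power_mult_distrib exp_add mult_ac)
qed

text \<open>With \<open>a k = k + m + 1\<close>, the product of
  \<open>(a (k + 1) / a k) ^ (k + 1)\<close> over \<open>k < N\<close> telescopes to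
  \<open>a N ^ N\<close> divided by the product of the \<open>a k\<close>, which is
  \<open>fact (N + m) / fact m\<close>. The exponents add up to a harmonic number.\<close>

lemma barnes_partial_product_plus1:
  "(\<Prod>k<N. barnes_factor (real (Suc m)) k) = (\<Prod>k<N. barnes_factor (real m) k) *
     (fact m * (real N + real m + 1) ^ N * exp (- real N) * exp ((real m + 1/2) * harm N) / fact (N + m))"
proof (induction N)
  case (Suc N)
  let ?a = "real N + real m + 1"
  have e: "exp (- real (Suc N)) * exp ((real m + 1/2) * harm (Suc N)) =
      exp (- real N) * exp ((real m + 1/2) * harm N) * exp ((real m + 1/2) / real (Suc N) - 1)"
    unfolding exp_add[symmetric] by (simp add: harm_Suc field_simps)
  have f: "(fact (Suc N + m) :: real) = ?a * fact (N + m)"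
    by (simp add: algebra_simps)
  have p: "?a > 0" by simp
  have "(\<Prod>k<Suc N. barnes_factor (real (Suc m)) k) =
      (\<Prod>k<Suc N. barnes_factor (real m) k) *
      (fact m * (?a ^ N * ((real N + real m + 2) / ?a) ^ Suc N / ?a) *
        (?a * (exp (- real (Suc N)) * exp ((real m + 1/2) * harm (Suc N))) / fact (N + m)))"
    using p unfolding e unfolding prod.lessThan_Suc Suc.IH unfolding barnes_factor_plus1 by (simp add: mult_ac del: power_Suc)
  also have "?a ^ N * ((real N + real m + 2) / ?a) ^ Suc N / ?a = (real N + real m + 2) ^ Suc N / (?a * ?a)"
    using p by (simp add: power_divide)
  also have "fact m * ((real N + real m + 2) ^ Suc N / (?a * ?a)) * (?a * (x * y) / z) =
      fact m * (real N + real m + 2) ^ Suc N * x * y / (?a * z)" for x y z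
    using p by simp
  finally show ?case
    unfolding f by (simp add: add_ac del: power_Suc fact_Suc)
qed (simp add: harm_def)

text \<open>Stirling's formula handles the factorial and Euler's constant the harmonic number; the
  remaining powers of \<open>N\<close> balance.\<close>

lemma barnes_step_tendsto:
  "(\<lambda>N. fact m * (real N + real m + 1) ^ N * exp (- real N) * exp ((real m + 1/2) * harm N) / fact (N + m))
     \<longlonglongrightarrow> fact m * exp (real m + 1 + euler_mascheroni * (real m + 1/2)) / sqrt (2 * pi)"
proof -
  \<comment> \<open>An exact rearrangement for \<open>N > 0\<close> into factors with known limits:
    \<open>N ^ (m + 1/2)\<close>, split off from the harmonic exponential, is absorbed by the last
    two factors.\<close>
  define g where "g N = fact m / stirling_ratio (N + m) *
     exp ((real m + 1/2) * (harm N - ln (real N))) * exp (real m) *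
     (((real N + real m + 1) / (real N + real m)) ^ N *
      (real N / (real N + real m)) ^ m * sqrt (real N / (real N + real m)))" for N
  have "(\<lambda>N. stirling_ratio (N + m)) \<longlonglongrightarrow> sqrt (2 * pi)"
    using stirling_ratio_tendsto by (rule LIMSEQ_ignore_initial_segment)
  moreover have "(\<lambda>N. ((real N + real m + 1) / (real N + real m)) ^ N) \<longlonglongrightarrow> exp 1"
    by real_asymp
  moreover have quot: "(\<lambda>N. real N / (real N + real m)) \<longlonglongrightarrow> 1" by real_asymp
  moreover have "(\<lambda>N. (real N / (real N + real m)) ^ m) \<longlonglongrightarrow> 1"
    using tendsto_power[OF quot, of m] by simp
  moreover have "(\<lambda>N. sqrt (real N / (real N + real m))) \<longlonglongrightarrow> 1"
    using tendsto_real_sqrt[OF quot] by simp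
  ultimately have "g \<longlonglongrightarrow> fact m / sqrt (2 * pi) * exp ((real m + 1/2) * euler_mascheroni) * exp (real m) * (exp 1 * 1 * 1)"
    unfolding g_def by (intro tendsto_intros euler_mascheroni_LIMSEQ) auto
  also have "fact m / sqrt (2 * pi) * exp ((real m + 1/2) * euler_mascheroni) * exp (real m) * (exp 1 * 1 * 1) =
      fact m * exp (real m + 1 + euler_mascheroni * (real m + 1/2)) / sqrt (2 * pi)"
    by (simp add: exp_add[symmetric] algebra_simps)
  finally show ?thesis
  proof (rule Lim_transform_eventually)
    show "\<forall>\<^sub>F N in sequentially. g N = fact m * (real N + real m + 1) ^ N * exp (- real N) *
        exp ((real m + 1/2) * harm N) / fact (N + m)"
      using eventually_gt_at_top[of 0]
    proof eventually_elim
      case (elim N)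
      define b s t where "b = real N + real m" and "s = sqrt (real N)" and "t = sqrt b"
      have pos: "b > 0" "s > 0" "t > 0" "real N > 0" using elim by (auto simp: b_def s_def t_def)
      have E: "exp ((real m + 1/2) * (harm N - ln (real N))) = exp ((real m + 1/2) * harm N) / (real N ^ m * s)"
      proof -
        have "exp (ln (real N) / 2) = s"
          using elim by (simp add: s_def ln_sqrt[symmetric])
        then have "exp ((real m + 1/2) * ln (real N)) = real N ^ m * s"
          using elim by (simp add: distrib_right exp_add exp_of_nat_mult)
        then show ?thesis by (simp add: right_diff_distrib exp_diff)
      qed
      have S: "stirling_ratio (N + m) = fact (N + m) * (exp (real N) * exp (real m)) / (b ^ N * b ^ m * t)"
        by (simp add: stirling_ratio_def b_def t_def exp_add power_add)
      show ?case
        using pos unfolding g_def E S b_def[symmetric]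
        by (simp add: real_sqrt_divide s_def[symmetric] t_def[symmetric] power_divide exp_minus field_simps)
    qed
  qed
qed

lemma barnes_partial_product_tendsto:
  "(\<lambda>N. \<Prod>k<N. barnes_factor (real m) k) \<longlonglongrightarrow>
     (\<Prod>i<m. fact i * exp (real i + 1 + euler_mascheroni * (real i + 1/2)) / sqrt (2 * pi))"
proof (induction m)
  case (Suc m)
  show ?case
    unfolding barnes_partial_product_plus1 prod.lessThan_Suc
    by (intro tendsto_mult Suc.IH barnes_step_tendsto)
qed (simp add: barnes_factor_def)

theorem barnes_G_of_nat_Suc: "barnes_G (real m + 1) = (\<Prod>i<m. fact i)"
proof -
  let ?P = "\<Prod>i<m. fact i * exp (real i + 1 + euler_mascheroni * (real i + 1/2)) / sqrt (2 * pi)"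
  have "(\<lambda>N. \<Prod>k\<le>N. barnes_factor (real m) k) \<longlonglongrightarrow> ?P"
    using barnes_partial_product_tendsto[of m, THEN LIMSEQ_Suc] by (simp add: lessThan_Suc_atMost)
  \<comment> \<open>Convergence of an infinite product with offset 0 also demands a nonzero limit;
    \<open>?P\<close> is a product of positive terms.\<close>
  then have "barnes_factor (real m) has_prod ?P"
    by (simp add: has_prod_def raw_has_prod_def)
  then have "prodinf (barnes_factor (real m)) = ?P"
    by (rule has_prod_unique[symmetric])
  then have "barnes_G (real m + 1) =
      exp (ln (2 * pi) * real m / 2) * exp (- (real m + (real m)\<^sup>2 * (1 + euler_mascheroni)) / 2) * ?P"
    by (simp add: barnes_G_def barnes_factor_def[abs_def])
  \<comment> \<open>Passing from \<open>m\<close> to \<open>m + 1\<close> multiplies the two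
    prefactors by exactly the inverse of what accompanies \<open>fact m\<close> in the
    product.\<close>
  also have "\<dots> = (\<Prod>i<m. fact i)"
  proof (induction m)
    case (Suc m)
    have "exp (ln (2 * pi) * real (Suc m) / 2) = exp (ln (2 * pi) * real m / 2) * sqrt (2 * pi)"
    proof -
      have "exp (ln (2 * pi) / 2) = sqrt (2 * pi)"
        using powr_half_sqrt[of "2 * pi"] by (simp add: powr_def)
      then show ?thesis by (simp add: distrib_left add_divide_distrib exp_add)
    qed
    moreover have "exp (- (real (Suc m) + (real (Suc m))\<^sup>2 * (1 + euler_mascheroni)) / 2) *
        exp (real m + 1 + euler_mascheroni * (real m + 1/2)) =
        exp (- (real m + (real m)\<^sup>2 * (1 + euler_mascheroni :: real)) / 2)"
      unfolding exp_add[symmetric] by (simp add: power2_eq_square field_simps)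
    moreover have "(a * sqrt (2 * pi)) * b * (p * (f * x / sqrt (2 * pi))) = (a * (b * x) * p) * f"
      for a b f p x :: real by simp
    ultimately show ?case
      unfolding prod.lessThan_Suc by (simp only: Suc.IH)
  qed simp
  finally show ?thesis .
qed

section \<open>Gaussian moments of the Hermite polynomials\<close>

text \<open>The \<open>m\<close>-th moment of the density \<open>exp (-x\<^sup>2) / sqrt pi\<close>.\<close>

definition gauss_moment :: "nat \<Rightarrow> real" where
  "gauss_moment m = (1 + (-1) ^ m) / (2 * sqrt pi) * Gamma ((real m + 1) / 2)"

lemma gauss_moment_0: "gauss_moment 0 = 1"
  by (simp add: gauss_moment_def Gamma_one_half_real)

text \<open>Integration by parts against \<open>exp (-x^2)\<close>, here from the functional
  equation of Gamma. At \<open>m = 0\<close> the truncated \<open>m - 1\<close> meets the factor 0,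
  and the first moment vanishes by parity.\<close>

lemma gauss_moment_Suc: "2 * gauss_moment (Suc m) = real m * gauss_moment (m - 1)"
proof (cases m)
  case (Suc k)
  have "Gamma ((real k + 1) / 2 + 1) = (real k + 1) / 2 * Gamma ((real k + 1) / 2)"
    by (rule Gamma_plus1) (use nonpos_Ints_nonpos[of "(real k + 1) / 2"] in force)
  moreover have "(real (Suc (Suc k)) + 1) / 2 = (real k + 1) / 2 + 1" by (simp add: field_simps)
  ultimately have Gamma_eq: "Gamma ((real (Suc (Suc k)) + 1) / 2) = (real k + 1) / 2 * Gamma ((real k + 1) / 2)"
    by (simp only:)
  show ?thesis unfolding gauss_moment_def Suc Gamma_eq by (simp add: field_simps)
qed (simp add: gauss_moment_def)

text \<open>Since \<open>0 ^ 0 = 1\<close>, only the constant term, with \<open>2 * m = n\<close>,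
  survives.\<close>

lemma hermite_at_0:
  "hermite n 0 = (if even n then (-1) ^ (n div 2) * fact n / fact (n div 2) else 0)"
proof -
  have "hermite n 0 = (\<Sum>m\<le>n div 2. if 2 * m = n then (-1) ^ m * fact n / fact m else 0)"
    unfolding hermite_def by (intro sum.cong) (auto simp: power_0_left)
  also have "\<dots> = (\<Sum>m\<in>{m\<in>{..n div 2}. 2 * m = n}. (-1) ^ m * fact n / fact m)"
    by (rule sum.inter_filter[symmetric]) simp
  also have "{m\<in>{..n div 2}. 2 * m = n} = (if even n then {n div 2} else {})" by auto
  finally show ?thesis by simp
qed

lemma hermite_0_at_0: "hermite 0 0 = 1"
  and hermite_1_at_0: "hermite (Suc 0) 0 = 0"
  by (simp_all add: hermite_at_0)

lemma hermite_Suc_Suc_at_0: "hermite (Suc (Suc n)) 0 = - 2 * (real n + 1) * hermite n 0"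
proof (cases "even n")
  case True
  then obtain k where "n = 2 * k" by auto
  then show ?thesis by (simp add: hermite_at_0 divide_simps) (simp add: algebra_simps)
qed (simp add: hermite_at_0)

text \<open>The coefficient of \<open>x\<^sup>i\<close> in \<open>H\<^sub>k\<close>, by Taylor expansion with \<open>H\<^sub>k' = 2 k H\<^sub>k\<^sub>-\<^sub>1\<close>.\<close>

definition hermite_coeff :: "nat \<Rightarrow> nat \<Rightarrow> real" where
  "hermite_coeff k i = 2 ^ i * real (k choose i) * hermite (k - i) 0"

lemma hermite_coeff_eq_0: "i > k \<Longrightarrow> hermite_coeff k i = 0"
  by (simp add: hermite_coeff_def)

lemma hermite_coeff_diag: "hermite_coeff k k = 2 ^ k"
  by (simp add: hermite_coeff_def hermite_0_at_0)

lemma hermite_coeff_rec_0: "hermite_coeff (Suc (Suc k)) 0 = - 2 * (real k + 1) * hermite_coeff k 0"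
  by (simp add: hermite_coeff_def hermite_Suc_Suc_at_0)

text \<open>Coefficient form of \<open>H_(k+2) = 2 x H_(k+1) - 2 (k+1) H_k\<close>. For
  \<open>i < k\<close> it comes down to Pascal's rule and binomial absorption; the other cases lie
  at or beyond the degree, where subtraction truncates.\<close>

lemma hermite_coeff_rec_Suc:
  "hermite_coeff (Suc (Suc k)) (Suc i) =
     2 * hermite_coeff (Suc k) i - 2 * (real k + 1) * hermite_coeff k (Suc i)"
proof -
  consider "i < k" | "i = k" | "i = Suc k" | "i > Suc k" by linarith
  then show ?thesis
  proof cases
    case 1
    \<comment> \<open>All three Hermite values become multiples of
      \<open>hermite d 0\<close>.\<close>
    define d where "d = k - Suc i"
    have k: "k = Suc (d + i)" using 1 by (simp add: d_def)
    have "(Suc k choose Suc i) * (d + 1) = (k + 1) * (k choose Suc i)"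
      using binomial_absorb_comp[of "Suc k" "Suc i"] by (simp add: k mult.commute)
    then have "real (Suc k choose Suc i) * (real d + 1) = (real k + 1) * real (k choose Suc i)"
      by (metis of_nat_mult of_nat_add of_nat_1)
    moreover have "hermite (Suc (Suc k) - Suc i) 0 = - 2 * (real d + 1) * hermite d 0"
      "hermite (Suc k - i) 0 = - 2 * (real d + 1) * hermite d 0" "hermite (k - Suc i) 0 = hermite d 0"
      by (simp_all add: k hermite_Suc_Suc_at_0)
    moreover have "real (Suc (Suc k) choose Suc i) = real (Suc k choose i) + real (Suc k choose Suc i)"
      by simp
    moreover have "2 * 2 ^ i * (A + B) * (- 2 * D * h) = 2 * (2 ^ i * A * (- 2 * D * h)) - 2 * (2 * 2 ^ i * (B * D) * h)"
      for A B D h :: real by (simp add: algebra_simps)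
    ultimately show ?thesis
      unfolding hermite_coeff_def by (simp only: power_Suc) (simp only: mult_ac)
  next
    case 2
    then show ?thesis by (simp add: hermite_coeff_def hermite_1_at_0)
  next
    case 3
    then show ?thesis by (simp add: hermite_coeff_def hermite_0_at_0)
  next
    case 4
    then show ?thesis by (simp add: hermite_coeff_eq_0)
  qed
qed

text \<open>The integral of \<open>H\<^sub>k(x) x\<^sup>j\<close> against \<open>exp (-x\<^sup>2) / sqrt pi\<close>.\<close>

definition hermite_moment :: "nat \<Rightarrow> nat \<Rightarrow> real" where
  "hermite_moment k j = (\<Sum>i\<le>k. hermite_coeff k i * gauss_moment (i + j))"

lemma hermite_moment_eq:
  assumes "k \<le> N"
  shows "hermite_moment k j = (\<Sum>i\<le>N. hermite_coeff k i * gauss_moment (i + j))"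
  unfolding hermite_moment_def using assms
  by (intro sum.mono_neutral_left) (auto simp: hermite_coeff_eq_0)

text \<open>The three-term recurrence integrated against \<open>x^j\<close>; the factor
  \<open>x\<close> raises \<open>j\<close> by one.\<close>

lemma hermite_moment_Suc_Suc:
  "hermite_moment (Suc (Suc k)) j =
     2 * hermite_moment (Suc k) (Suc j) - 2 * (real k + 1) * hermite_moment k j"
proof -
  have "hermite_moment (Suc (Suc k)) j = - 2 * (real k + 1) * hermite_coeff k 0 * gauss_moment j +
      (\<Sum>i\<le>Suc k. (2 * hermite_coeff (Suc k) i - 2 * (real k + 1) * hermite_coeff k (Suc i)) * gauss_moment (Suc i + j))"
    unfolding hermite_moment_def
    by (subst sum.atMost_Suc_shift) (simp add: hermite_coeff_rec_0 hermite_coeff_rec_Suc del: sum.atMost_Suc)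
  also have "\<dots> = 2 * (\<Sum>i\<le>Suc k. hermite_coeff (Suc k) i * gauss_moment (i + Suc j)) - 2 * (real k + 1) *
     (hermite_coeff k 0 * gauss_moment j + (\<Sum>i\<le>Suc k. hermite_coeff k (Suc i) * gauss_moment (Suc i + j)))"
    by (simp add: algebra_simps sum_subtractf sum_distrib_left del: sum.atMost_Suc)
  also have "hermite_coeff k 0 * gauss_moment j + (\<Sum>i\<le>Suc k. hermite_coeff k (Suc i) * gauss_moment (Suc i + j)) = hermite_moment k j"
    by (subst hermite_moment_eq[of k "Suc (Suc k)"], simp, subst sum.atMost_Suc_shift) simp
  finally show ?thesis by (simp only: hermite_moment_def[of "Suc k"])
qed

text \<open>Integration by parts with \<open>H\<^sub>k\<^sub>+\<^sub>1(x) exp (-x\<^sup>2) = - (H\<^sub>k(x) exp (-x\<^sup>2))'\<close>,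
  carried out algebraically from the three-term recurrence. For \<open>j = 0\<close> the truncated
  \<open>j - 1\<close> is harmless because of the factor \<open>j\<close>.\<close>

lemma hermite_moment_Suc: "hermite_moment (Suc k) j = real j * hermite_moment k (j - 1)"
proof (induction k arbitrary: j rule: less_induct)
  case (less k)
  show ?case
  proof (cases k)
    case 0
    then show ?thesis
      using gauss_moment_Suc[of j]
      by (simp add: hermite_moment_def hermite_coeff_def hermite_0_at_0 hermite_1_at_0)
  next
    case (Suc l)
    have IH1: "hermite_moment (Suc l) i = real i * hermite_moment l (i - 1)" for i
      by (rule less.IH) (simp add: Suc)
    \<comment> \<open>This is what remains of the goal once the recurrence and \<open>IH1\<close> at
      \<open>Suc j\<close> are applied to its left-hand side.\<close>
    have 2: "real j * hermite_moment (Suc l) (j - 1) =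
       2 * (real j - real l) * hermite_moment l j"
    proof (cases j)
      case 0
      have "real l * hermite_moment l 0 = 0"
        by (cases l) (simp_all add: less.IH Suc)
      with 0 show ?thesis by simp
    next
      case (Suc i)
      show ?thesis
      proof (cases l)
        case 0
        then show ?thesis
          by (simp add: Suc hermite_moment_def hermite_coeff_def hermite_0_at_0 hermite_1_at_0)
      next
        case (Suc q)
        have "hermite_moment (Suc q) j = real j * hermite_moment q (j - 1)"
          by (rule less.IH) (simp add: Suc \<open>k = Suc l\<close>)
        with \<open>j = Suc i\<close> show ?thesis
          by (simp add: Suc hermite_moment_Suc_Suc del: of_nat_Suc) (simp add: algebra_simps)
      qed
    qed
    show ?thesis
      using 2 by (simp add: Suc hermite_moment_Suc_Suc IH1[of "Suc j"] algebra_simps)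
  qed
qed

text \<open>Each use of \<open>hermite_moment_Suc\<close> lowers both indices; \<open>j\<close>
  reaches 0 first, and there the factor \<open>real j\<close> vanishes.\<close>

lemma hermite_moment_less: "j < k \<Longrightarrow> hermite_moment k j = 0"
proof (induction k arbitrary: j)
  case (Suc k)
  then show ?case by (cases j) (simp_all add: hermite_moment_Suc)
qed simp

lemma hermite_moment_diag: "hermite_moment k k = fact k"
  by (induction k) (simp_all add: hermite_moment_Suc,
      simp add: hermite_moment_def hermite_coeff_def hermite_0_at_0 gauss_moment_0)

text \<open>For \<open>l \<le> k\<close> only \<open>j = k\<close> contributes: below it the moment
  of \<open>H_k\<close> vanishes, above it the coefficient of \<open>H_l\<close>. The opposite order
  follows because the moment matrix is symmetric.\<close>

lemma hermite_orthogonal: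
  assumes "k \<le> n" "l \<le> n"
  shows "(\<Sum>j\<le>n. (\<Sum>i\<le>n. hermite_coeff k i * gauss_moment (i + j)) * hermite_coeff l j) =
    (if k = l then fact k * 2 ^ k else 0)"
proof -
  define S where "S k l = (\<Sum>j\<le>n. (\<Sum>i\<le>n. hermite_coeff k i * gauss_moment (i + j)) * hermite_coeff l j)" for k l
  have sym: "S k l = S l k" for k l
  proof -
    have "S k l = (\<Sum>j\<le>n. \<Sum>i\<le>n. hermite_coeff l j * gauss_moment (j + i) * hermite_coeff k i)"
      unfolding S_def sum_distrib_right by (intro sum.cong) (simp_all add: ac_simps)
    also have "\<dots> = S l k"
      unfolding S_def sum_distrib_right by (rule sum.swap)
    finally show ?thesis .
  qed
  have le: "S k l = (if k = l then fact k * 2 ^ k else 0)" if "l \<le> k" "k \<le> n" for k l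
  proof -
    have "S k l = (\<Sum>j\<le>n. if j = k then (if k = l then fact k * 2 ^ k else 0) else 0)"
      unfolding S_def
    proof (rule sum.cong)
      fix j
      have "hermite_moment k j * hermite_coeff l j = (if j = k then if k = l then fact k * 2 ^ k else 0 else 0)"
        using that
        by (cases j k rule: linorder_cases)
          (auto simp: hermite_moment_less hermite_moment_diag hermite_coeff_diag hermite_coeff_eq_0)
      then show "(\<Sum>i\<le>n. hermite_coeff k i * gauss_moment (i + j)) * hermite_coeff l j =
          (if j = k then if k = l then fact k * 2 ^ k else 0 else 0)"
        by (simp add: hermite_moment_eq[OF that(2)])
    qed simp
    then show ?thesis using that by simp
  qed
  have "S k l = (if k = l then fact k * 2 ^ k else 0)"
    using le[of l k] le[of k l] sym[of k l] assms by (cases "l \<le> k") auto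
  then show ?thesis by (simp add: S_def)
qed

section \<open>The moment matrix\<close>

lemma prod_two_power_atMost: "(\<Prod>k\<le>n. 2 ^ k :: real) = 2 powr (real n * (real n + 1) / 2)"
proof (induction n)
  case (Suc n)
  have "real (Suc n) * (real (Suc n) + 1) / 2 = real n * (real n + 1) / 2 + real (Suc n)"
    by (simp add: field_simps)
  then show ?case
    by (simp only: prod.atMost_Suc Suc.IH powr_add powr_realpow zero_less_numeral)
qed simp

theorem theorem2p1:
  fixes n :: nat
  shows
    "let A = mat (n + 1) (n + 1) (\<lambda>(i, j).
               (1 + (-1) ^ (i + j)) / (2 * sqrt pi) * Gamma ((real i + real j + 1) / 2));
         B = mat (n + 1) (n + 1) (\<lambda>(i, j).
               \<Sum>k = max i j..n.
                 2 ^ (i + j) * real (k choose i) * hermite (k - i) 0 *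
                   real (k choose j) * hermite (k - j) 0 / (fact k * 2 ^ k))
     in Determinant.det A = 2 powr (- (real n * (real n + 1) / 2)) * barnes_G (real n + 2) \<and>
        inverts_mat A B \<and> inverts_mat B A"
proof -
  define A where "A = mat (n + 1) (n + 1) (\<lambda>(i, j).
    (1 + (-1) ^ (i + j)) / (2 * sqrt pi) * Gamma ((real i + real j + 1) / 2))"
  define B where "B = mat (n + 1) (n + 1) (\<lambda>(i, j). \<Sum>k = max i j..n.
    2 ^ (i + j) * real (k choose i) * hermite (k - i) 0 *
      real (k choose j) * hermite (k - j) 0 / (fact k * 2 ^ k))"
  define C where "C = mat (n + 1) (n + 1) (\<lambda>(k, i). hermite_coeff k i)"
  \<comment> \<open>\<open>E\<close> is the transpose of \<open>C\<close> times the inverse of the diagonal matrix \<open>C A C\<^sup>T\<close>.\<close>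
  define E where "E = mat (n + 1) (n + 1) (\<lambda>(i, k). hermite_coeff k i / (fact k * 2 ^ k))"
  have carrier: "A \<in> carrier_mat (n + 1) (n + 1)" "B \<in> carrier_mat (n + 1) (n + 1)"
    "C \<in> carrier_mat (n + 1) (n + 1)" "E \<in> carrier_mat (n + 1) (n + 1)"
    by (simp_all add: A_def B_def C_def E_def)
  have range: "{0..<n + 1} = {..n}" by auto
  have A_eq: "A = mat (n + 1) (n + 1) (\<lambda>(i, j). gauss_moment (i + j))"
    by (simp add: A_def gauss_moment_def)
  have CA: "C * A = mat (n + 1) (n + 1) (\<lambda>(k, j). \<Sum>i\<le>n. hermite_coeff k i * gauss_moment (i + j))"
    by (rule eq_matI) (simp_all add: A_eq C_def scalar_prod_def range[simplified])
  have CAE: "C * A * E = 1\<^sub>m (n + 1)"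
  proof (rule eq_matI)
    fix k l assume kl: "k < dim_row (1\<^sub>m (n + 1))" "l < dim_col (1\<^sub>m (n + 1))"
    then have "(C * A * E) $$ (k, l) =
        (\<Sum>j\<le>n. (\<Sum>i\<le>n. hermite_coeff k i * gauss_moment (i + j)) * hermite_coeff l j) / (fact l * 2 ^ l)"
      by (simp add: CA E_def scalar_prod_def range[simplified] sum_divide_distrib)
    also have "\<dots> = 1\<^sub>m (n + 1) $$ (k, l)"
      using kl by (subst hermite_orthogonal) auto
    finally show "(C * A * E) $$ (k, l) = 1\<^sub>m (n + 1) $$ (k, l)" .
  qed (simp_all add: C_def E_def)
  have EC: "E * C = B"
  proof (rule eq_matI)
    fix i j assume ij: "i < dim_row B" "j < dim_col B"
    have "(E * C) $$ (i, j) = (\<Sum>k\<le>n. hermite_coeff k i / (fact k * 2 ^ k) * hermite_coeff k j)"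
      using ij by (simp add: B_def C_def E_def scalar_prod_def range[simplified])
    also have "\<dots> = (\<Sum>k = max i j..n. hermite_coeff k i / (fact k * 2 ^ k) * hermite_coeff k j)"
      by (rule sum.mono_neutral_right) (auto simp: hermite_coeff_eq_0)
    also have "\<dots> = B $$ (i, j)"
      using ij by (simp add: B_def hermite_coeff_def power_add mult_ac)
    finally show "(E * C) $$ (i, j) = B $$ (i, j)" .
  qed (simp_all add: B_def C_def E_def)
  \<comment> \<open>A one-sided inverse of a square matrix is two-sided, so \<open>C\<close> can
    move to the right of \<open>A * E\<close>, where it forms \<open>E * C = B\<close>.\<close>
  have "C * (A * E) = 1\<^sub>m (n + 1)"
    using CAE assoc_mult_mat[OF carrier(3,1,4)] by simp
  then have "A * E * C = 1\<^sub>m (n + 1)"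
    by (intro mat_mult_left_right_inverse[OF carrier(3)] mult_carrier_mat[OF carrier(1,4)])
  then have AB: "A * B = 1\<^sub>m (n + 1)"
    using assoc_mult_mat[OF carrier(1,4,3)] EC by simp
  then have BA: "B * A = 1\<^sub>m (n + 1)"
    by (rule mat_mult_left_right_inverse[OF carrier(1,2)])
  have "Determinant.det C = (\<Prod>k\<le>n. 2 ^ k)"
    by (subst det_lower_triangular[of "n + 1"])
      (simp_all add: C_def hermite_coeff_eq_0 prod_list_diag_prod range[simplified] hermite_coeff_diag)
  then have det_C: "Determinant.det C = 2 powr (real n * (real n + 1) / 2)"
    by (simp only: prod_two_power_atMost)
  \<comment> \<open>The diagonal entries \<open>2 ^ k / (fact k * 2 ^ k)\<close> lose their powers
    of two.\<close>
  have "Determinant.det E = (\<Prod>k\<le>n. 1 / fact k)"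
    by (subst det_upper_triangular[of _ "n + 1"])
      (auto simp: E_def upper_triangular_def hermite_coeff_eq_0 prod_list_diag_prod range[simplified] hermite_coeff_diag)
  also have "\<dots> = 1 / barnes_G (real n + 2)"
    using barnes_G_of_nat_Suc[of "Suc n"] by (simp add: lessThan_Suc_atMost add_ac prod_dividef)
  finally have det_E: "Determinant.det E = 1 / barnes_G (real n + 2)" .
  have "Determinant.det C * Determinant.det A * Determinant.det E = 1"
    using arg_cong[OF CAE, of Determinant.det]
    by (simp add: det_mult[OF mult_carrier_mat[OF carrier(3,1)] carrier(4)] det_mult[OF carrier(3,1)])
  \<comment> \<open>Were this value 0, its reciprocal would be 0 as well, contradicting the product
    1; hence the division can be cleared.\<close>
  moreover from this have "barnes_G (real n + 2) \<noteq> 0"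
    unfolding det_E by (metis div_by_0 mult_zero_right zero_neq_one)
  ultimately have G: "2 powr (real n * (real n + 1) / 2) * Determinant.det A = barnes_G (real n + 2)"
    unfolding det_C det_E by simp
  have "Determinant.det A = 2 powr (- (real n * (real n + 1) / 2)) * barnes_G (real n + 2)"
    by (simp add: G[symmetric] powr_minus)
  moreover have "inverts_mat A B" "inverts_mat B A"
    using AB BA carrier_matD(1)[OF carrier(1)] carrier_matD(1)[OF carrier(2)]
    by (simp_all add: inverts_mat_def)
  ultimately show ?thesis
    unfolding Let_def A_def B_def by blast
qed

end
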